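(* Let $(\boldsymbol{x},\boldsymbol{\nu}_1,\boldsymbol{\nu}_2):U\to H^3\times\Delta_5$ be a hyperbolic generalized framed surface. Denote $\boldsymbol{x}=(x_1,x_2,x_3,x_4)$, $\boldsymbol{\nu}_1=(y_1,y_2,y_3,y_4)$ and $\boldsymbol{\nu}_2=(z_1,z_2,z_3,z_4)$. Then $(\overline{\boldsymbol{x}},\overline{\boldsymbol{\nu}}_1,\overline{\boldsymbol{\nu}}_2):U\to D^3\times\Delta$ is a generalized framed surface, where $$\overline{\boldsymbol{x}}=\Bigl(\frac{x_2}{x_1+1},\frac{x_3}{x_1+1},\frac{x_4}{x_1+1}\Bigr),\quad \overline{\boldsymbol{\nu}}_1=\frac{(p_1,q_1,r_1)}{\sqrt{p_1^2+q_1^2+r_1^2}},\quad \overline{\boldsymbol{\nu}}_2=\frac{(p_2,q_2,r_2)}{\sqrt{p_2^2+q_2^2+r_2^2}},$$ $p_1=x_2y_1-x_1y_2-y_2$, $q_1=x_3y_1-x_1y_3-y_3$, $r_1=x_4y_1-x_1y_4-y_4$, $p_2=x_2z_1-x_1z_2-z_2$, $q_2=x_3z_1-x_1z_3-z_3$, $r_2=x_4z_1-x_1z_4-z_4$.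
   Context: $\mathbb{R}^4_1$ is $\mathbb{R}^4$ with the pseudo inner product $\langle \boldsymbol{x},\boldsymbol{y}\rangle=-x_1y_1+x_2y_2+x_3y_3+x_4y_4$. The pseudo vector product $\boldsymbol{x}\wedge\boldsymbol{y}\wedge\boldsymbol{z}$ of three vectors of $\mathbb{R}^4_1$ is the unique vector with $\langle \boldsymbol{w},\boldsymbol{x}\wedge\boldsymbol{y}\wedge\boldsymbol{z}\rangle=\det(\boldsymbol{w},\boldsymbol{x},\boldsymbol{y},\boldsymbol{z})$ for all $\boldsymbol{w}\in\mathbb{R}^4_1$. $H^3=\{\boldsymbol{x}\in\mathbb{R}^4_1: \langle\boldsymbol{x},\boldsymbol{x}\rangle=-1,\ x_1>0\}$, $S^3_1=\{\boldsymbol{x}\in\mathbb{R}^4_1:\langle\boldsymbol{x},\boldsymbol{x}\rangle=1\}$, $\Delta_5=\{(\boldsymbol{\nu}_1,\boldsymbol{\nu}_2)\in S^3_1\times S^3_1:\langle\boldsymbol{\nu}_1,\boldsymbol{\nu}_2\rangle=0\}$. $U$ is a simply connected open subset of $\mathbb{R}^2$ with coordinates $(u,v)$; subscripts $u,v$ on maps denote partial derivatives; all maps are $C^\infty$. Hyperbolic generalized framed surface: a smooth map $(\boldsymbol{x},\boldsymbol{\nu}_1,\boldsymbol{\nu}_2):U\to H^3\times\Delta_5$ with $\langle\boldsymbol{x},\boldsymbol{\nu}_1\rangle=\langle\boldsymbol{x},\boldsymbol{\nu}_2\rangle=0$ on $U$ for which there are smooth functions $\alpha,\beta:U\to\mathbb{R}$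 with $\boldsymbol{x}\wedge\boldsymbol{x}_u\wedge\boldsymbol{x}_v=\alpha\boldsymbol{\nu}_1+\beta\boldsymbol{\nu}_2$ on $U$. $\mathbb{R}^3$ is Euclidean 3-space with the usual inner product $\cdot$ and cross product $\times$; $D^3=\{(x_1,x_2,x_3)\in\mathbb{R}^3:x_1^2+x_2^2+x_3^2<1\}$ is regarded as a subset of $\mathbb{R}^3$ with the induced Euclidean metric; $\Delta=\{(\boldsymbol{a},\boldsymbol{b})\in S^2\times S^2:\boldsymbol{a}\cdot\boldsymbol{b}=0\}$ with $S^2$ the unit sphere. A smooth map $(\overline{\boldsymbol{x}},\overline{\boldsymbol{\nu}}_1,\overline{\boldsymbol{\nu}}_2):U\to\mathbb{R}^3\times\Delta$ is a generalized framed surface if there are smooth functions $\overline{\alpha},\overline{\beta}:U\to\mathbb{R}$ with $\overline{\boldsymbol{x}}_u\times\overline{\boldsymbol{x}}_v=\overline{\alpha}\,\overline{\boldsymbol{\nu}}_1+\overline{\beta}\,\overline{\boldsymbol{\nu}}_2$ on $U$. *)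

theory Defs
  imports "HOL-Analysis.Analysis"
begin

text \<open>Smoothness (class \<open>C\<^sup>\<infinity>\<close>) on a set, to be used for open sets only: the derivatives are taken
  with respect to the full neighbourhood filter.\<close>

primrec Ck_on :: "nat \<Rightarrow> 'a set \<Rightarrow> ('a::real_normed_vector \<Rightarrow> 'b::real_normed_vector) \<Rightarrow> bool" where
  "Ck_on 0 U f \<longleftrightarrow> continuous_on U f"
| "Ck_on (Suc k) U f \<longleftrightarrow>
     (\<forall>p\<in>U. f differentiable (at p)) \<and> (\<forall>h. Ck_on k U (\<lambda>p. frechet_derivative f (at p) h))"

definition smooth_on :: "'a set \<Rightarrow> ('a::real_normed_vector \<Rightarrow> 'b::real_normed_vector) \<Rightarrow> bool" where
  "smooth_on U f \<longleftrightarrow> (\<forall>k. Ck_on k U f)"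

definition partial :: "2 \<Rightarrow> (real^2 \<Rightarrow> 'b::real_normed_vector) \<Rightarrow> real^2 \<Rightarrow> 'b" where
  "partial i f p = vector_derivative (\<lambda>t. f (p + t *\<^sub>R axis i 1)) (at 0)"

abbreviation partial_u :: "(real^2 \<Rightarrow> 'b::real_normed_vector) \<Rightarrow> real^2 \<Rightarrow> 'b" where
  "partial_u \<equiv> partial 1"

abbreviation partial_v :: "(real^2 \<Rightarrow> 'b::real_normed_vector) \<Rightarrow> real^2 \<Rightarrow> 'b" where
  "partial_v \<equiv> partial 2"

definition lorentz :: "real^4 \<Rightarrow> real^4 \<Rightarrow> real" where
  "lorentz x y = - (x$1 * y$1) + x$2 * y$2 + x$3 * y$3 + x$4 * y$4"

definition wedge3 :: "real^4 \<Rightarrow> real^4 \<Rightarrow> real^4 \<Rightarrow> real^4" where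
  "wedge3 x y z = (THE v. \<forall>w. lorentz w v = det (vector [w, x, y, z] :: real^4^4))"

definition H3 :: "(real^4) set" where
  "H3 = {x. lorentz x x = -1 \<and> x$1 > 0}"

definition S31 :: "(real^4) set" where
  "S31 = {x. lorentz x x = 1}"

definition Delta5 :: "((real^4) \<times> (real^4)) set" where
  "Delta5 = {(a, b). a \<in> S31 \<and> b \<in> S31 \<and> lorentz a b = 0}"

definition D3 :: "(real^3) set" where
  "D3 = {x. (x$1)\<^sup>2 + (x$2)\<^sup>2 + (x$3)\<^sup>2 < 1}"

definition Delta :: "((real^3) \<times> (real^3)) set" where
  "Delta = {(a, b). a \<in> sphere 0 1 \<and> b \<in> sphere 0 1 \<and> a \<bullet> b = 0}"

definition hyperbolic_generalized_framed_surface ::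
    "(real^2) set \<Rightarrow> (real^2 \<Rightarrow> real^4) \<Rightarrow> (real^2 \<Rightarrow> real^4) \<Rightarrow> (real^2 \<Rightarrow> real^4) \<Rightarrow> bool" where
  "hyperbolic_generalized_framed_surface U x \<nu>\<^sub>1 \<nu>\<^sub>2 \<longleftrightarrow>
     smooth_on U x \<and> smooth_on U \<nu>\<^sub>1 \<and> smooth_on U \<nu>\<^sub>2 \<and>
     (\<forall>p\<in>U. x p \<in> H3 \<and> (\<nu>\<^sub>1 p, \<nu>\<^sub>2 p) \<in> Delta5) \<and>
     (\<forall>p\<in>U. lorentz (x p) (\<nu>\<^sub>1 p) = 0 \<and> lorentz (x p) (\<nu>\<^sub>2 p) = 0) \<and>
     (\<exists>\<alpha> \<beta> :: real^2 \<Rightarrow> real. smooth_on U \<alpha> \<and> smooth_on U \<beta> \<and>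
       (\<forall>p\<in>U. wedge3 (x p) (partial_u x p) (partial_v x p) = \<alpha> p *\<^sub>R \<nu>\<^sub>1 p + \<beta> p *\<^sub>R \<nu>\<^sub>2 p))"

definition generalized_framed_surface ::
    "(real^2) set \<Rightarrow> (real^2 \<Rightarrow> real^3) \<Rightarrow> (real^2 \<Rightarrow> real^3) \<Rightarrow> (real^2 \<Rightarrow> real^3) \<Rightarrow> bool" where
  "generalized_framed_surface U x \<nu>\<^sub>1 \<nu>\<^sub>2 \<longleftrightarrow>
     smooth_on U x \<and> smooth_on U \<nu>\<^sub>1 \<and> smooth_on U \<nu>\<^sub>2 \<and>
     (\<forall>p\<in>U. (\<nu>\<^sub>1 p, \<nu>\<^sub>2 p) \<in> Delta) \<and>
     (\<exists>\<alpha> \<beta> :: real^2 \<Rightarrow> real. smooth_on U \<alpha> \<and> smooth_on U \<beta> \<and>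
       (\<forall>p\<in>U. cross3 (partial_u x p) (partial_v x p) = \<alpha> p *\<^sub>R \<nu>\<^sub>1 p + \<beta> p *\<^sub>R \<nu>\<^sub>2 p))"

definition bar_point :: "real^4 \<Rightarrow> real^3" where
  "bar_point x = vector [x$2 / (x$1 + 1), x$3 / (x$1 + 1), x$4 / (x$1 + 1)]"

text \<open>For \<open>y = \<nu>\<^sub>i\<close> the scalars \<open>p, q, r\<close> below are \<open>p\<^sub>i, q\<^sub>i, r\<^sub>i\<close>.\<close>

definition bar_normal :: "real^4 \<Rightarrow> real^4 \<Rightarrow> real^3" where
  "bar_normal x y =
     (let p = x$2 * y$1 - x$1 * y$2 - y$2;
          q = x$3 * y$1 - x$1 * y$3 - y$3;
          r = x$4 * y$1 - x$1 * y$4 - y$4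
      in (1 / sqrt (p\<^sup>2 + q\<^sup>2 + r\<^sup>2)) *\<^sub>R vector [p, q, r])"

text \<open>The vector in the description of \<^const>\<open>wedge3\<close> exists and is unique.\<close>

lemma vector_4_nth:
  "(vector [a, b, c, d] :: 'a::zero^4) $ 1 = a"
  "(vector [a, b, c, d] :: 'a::zero^4) $ 2 = b"
  "(vector [a, b, c, d] :: 'a::zero^4) $ 3 = c"
  "(vector [a, b, c, d] :: 'a::zero^4) $ 4 = d"
  by (simp_all add: vector_def)

lemma lorentz_axis:
  "lorentz (axis 1 1) v = - v$1" "lorentz (axis 2 1) v = v$2"
  "lorentz (axis 3 1) v = v$3" "lorentz (axis 4 1) v = v$4"
  by (simp_all add: lorentz_def axis_def)

lemma lorentz_eqD:
  assumes h: "\<And>w. lorentz w v = lorentz w v'"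
  shows "v = v'"
  using h[of "axis 1 1"] h[of "axis 2 1"] h[of "axis 3 1"] h[of "axis 4 1"]
  by (simp add: lorentz_axis vec_eq_iff forall_4)

lemma linear_det_first_row: "linear (\<lambda>w. det (vector [w, x, y, z] :: real^4^4))"
proof -
  have eq: "(vector [w, x, y, z] :: real^4^4) =
      (\<chi> i. if i = 1 then w else if i = 2 then x else if i = 3 then y else z)" for w
    by (simp add: vec_eq_iff forall_4 vector_4_nth)
  show ?thesis
    unfolding eq
    by (rule linearI)
      (simp_all only: det_row_add det_row_mul real_scaleR_def scalar_mult_eq_scaleR[symmetric])
qed

lemma wedge3: "lorentz w (wedge3 x y z) = det (vector [w, x, y, z] :: real^4^4)"
proof -
  define D where "D w = det (vector [w, x, y, z] :: real^4^4)" for w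
  define v :: "real^4" where
    "v = vector [- D (axis 1 1), D (axis 2 1), D (axis 3 1), D (axis 4 1)]"
  have "linear D"
    unfolding D_def by (rule linear_det_first_row)
  have v: "lorentz w v = D w" for w
  proof -
    have "D w = D (\<Sum>i\<in>UNIV. (w $ i) *\<^sub>R axis i 1)"
      by (simp only: scalar_mult_eq_scaleR[symmetric] basis_expansion)
    also have "\<dots> = (\<Sum>i\<in>UNIV. w $ i * D (axis i 1))"
      by (simp add: linear_sum[OF \<open>linear D\<close>] linear_scale[OF \<open>linear D\<close>])
    finally show ?thesis
      by (simp add: sum_4 lorentz_def v_def vector_4_nth)
  qed
  have "wedge3 x y z = v"
    unfolding wedge3_def D_def[symmetric]
  proof (rule the_equality)
    show "\<forall>w. lorentz w v = D w"
      by (simp add: v)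
    show "v' = v" if "\<forall>w. lorentz w v' = D w" for v'
      by (rule lorentz_eqD) (simp only: v that[rule_format])
  qed
  then show ?thesis
    by (simp only: v D_def)
qed

end

theory Submission
  imports Defs
begin

text \<open>The map \<open>bar_point\<close> is the stereographic projection of the hyperboloid \<open>H3\<close> onto the Poincare
  ball. Write \<open>X\<close> for the last three coordinates of \<open>x\<close> and \<open>s = x\<^sub>1 + 1\<close>, so that the projection is
  \<open>X / s\<close>. The numerator \<open>(p, q, r)\<close> of a projected normal is \<open>P y = y\<^sub>1 X - s Y\<close>
  (\<open>pre_normal\<close>), and the differential of the projection at \<open>x\<close> is exactly \<open>- P / s\<^sup>2\<close>. Up to
  normalization, the projected normals are therefore the images of the original normals under the
  differential, and everything follows from how \<open>P\<close> acts on vectors Lorentz-orthogonal to \<open>x\<close>.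

  Conformality of the projection reads \<open>P y \<bullet> P z = s\<^sup>2 \<langle>y, z\<rangle>\<close> (\<open>pre_normal_inner\<close>). Hence each
  \<open>P \<nu>\<^sub>i\<close> has length \<open>s\<close> and the two are orthogonal, so the projected normals \<open>P \<nu>\<^sub>i / s\<close> form an
  orthonormal pair. Since the square root in their definition equals \<open>s > 0\<close>, they are rational
  functions of smooth data, and smooth.

  A conformal map of oriented three-dimensional spaces respects the vector product up to a factor;
  here \<open>P a \<times> P b = s P (x \<and> a \<and> b)\<close> for \<open>a\<close>, \<open>b\<close> orthogonal to \<open>x\<close> (\<open>cross3_pre_normal\<close>). The
  partial derivatives of \<open>x\<close> are orthogonal to \<open>x\<close>, because \<open>\<langle>x, x\<rangle>\<close> is constant. Applying the
  identity to them and inserting \<open>x \<and> x\<^sub>u \<and> x\<^sub>v = \<alpha> \<nu>\<^sub>1 + \<beta> \<nu>\<^sub>2\<close> shows that the cross product of the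
  projected partial derivatives is the combination of the projected normals with coefficients
  \<open>\<alpha> / s\<^sup>2\<close> and \<open>\<beta> / s\<^sup>2\<close>.\<close>

section \<open>Smooth maps\<close>

lemma Ck_on_cong:
  assumes "open U" and "\<And>p. p \<in> U \<Longrightarrow> f p = g p"
  shows "Ck_on k U f \<longleftrightarrow> Ck_on k U g"
  using assms(2)
proof (induction k arbitrary: f g)
  case 0
  then show ?case
    by (simp cong: continuous_on_cong)
next
  case (Suc k)
  have *: "(f has_derivative D) (at p) \<longleftrightarrow> (g has_derivative D) (at p)" if "p \<in> U" for p D
    using that Suc.prems assms(1)
    by (metis has_derivative_transform_within_open)
  then have "frechet_derivative f (at p) = frechet_derivative g (at p)" if "p \<in> U" for p
    using that by (simp add: frechet_derivative_def)
  then have "Ck_on k U (\<lambda>p. frechet_derivative f (at p) h) \<longleftrightarrow>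
      Ck_on k U (\<lambda>p. frechet_derivative g (at p) h)" for h
    by (intro Suc.IH) simp
  with * show ?case
    by (simp add: differentiable_def)
qed

text \<open>\<open>Ck_on (Suc k)\<close> speaks of the derivatives only, so continuity of \<open>f\<close> itself has to be
  recovered from differentiability; this is the base case.\<close>
lemma Ck_on_Suc_imp_Ck_on: "Ck_on (Suc k) U f \<Longrightarrow> Ck_on k U f"
proof (induction k arbitrary: f)
  case 0
  then show ?case
    by (simp add: differentiable_at_imp_differentiable_on differentiable_imp_continuous_on)
next
  case (Suc k)
  then show ?case
    using Ck_on.simps(2) by blast
qed

lemma Ck_on_Suc_has_derivative:
  assumes "Ck_on (Suc k) U f" "p \<in> U"
  shows "(f has_derivative frechet_derivative f (at p)) (at p)"
  using assms by (simp add: frechet_derivative_works)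

text \<open>A derivative found by the calculus rules is the \<open>frechet_derivative\<close> only at points of \<open>U\<close>;
  openness of \<open>U\<close> makes this enough for the induction step.\<close>
lemma Ck_on_SucI:
  assumes "open U"
    and deriv: "\<And>p. p \<in> U \<Longrightarrow> (f has_derivative F p) (at p)"
    and smooth: "\<And>h. Ck_on k U (\<lambda>p. F p h)"
  shows "Ck_on (Suc k) U f"
proof -
  have "F p = frechet_derivative f (at p)" if "p \<in> U" for p
    using frechet_derivative_at deriv that by blast
  then have "Ck_on k U (\<lambda>p. F p h) = Ck_on k U (\<lambda>p. frechet_derivative f (at p) h)" for h
    by (intro Ck_on_cong[OF assms(1)]) simp
  then show ?thesis
    using deriv smooth by (auto simp: differentiable_def)
qed

lemma Ck_on_const: "Ck_on k U (\<lambda>_. c)"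
  by (induction k arbitrary: c) (simp_all add: frechet_derivative_const)

lemma Ck_on_bounded_linear:
  assumes "open U" "bounded_linear L" "Ck_on k U f"
  shows "Ck_on k U (\<lambda>p. L (f p))"
  using assms(3)
proof (induction k arbitrary: f)
  case 0
  then show ?case
    by (simp add: bounded_linear.continuous_on[OF assms(2)])
next
  case (Suc k)
  show ?case
  proof (rule Ck_on_SucI[OF assms(1)])
    show "((\<lambda>p. L (f p)) has_derivative (\<lambda>h. L (frechet_derivative f (at p) h))) (at p)"
      if "p \<in> U" for p
      by (rule bounded_linear.has_derivative[OF assms(2) Ck_on_Suc_has_derivative[OF Suc.prems that]])
    show "Ck_on k U (\<lambda>p. L (frechet_derivative f (at p) h))" for h
      using Suc.prems by (auto intro: Suc.IH)
  qed
qed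

lemma Ck_on_add:
  assumes "open U" "Ck_on k U f" "Ck_on k U g"
  shows "Ck_on k U (\<lambda>p. f p + g p)"
  using assms(2,3)
proof (induction k arbitrary: f g)
  case 0
  then show ?case
    by (simp add: continuous_on_add)
next
  case (Suc k)
  show ?case
  proof (rule Ck_on_SucI[OF assms(1)])
    show "((\<lambda>p. f p + g p) has_derivative
        (\<lambda>h. frechet_derivative f (at p) h + frechet_derivative g (at p) h)) (at p)"
      if "p \<in> U" for p
      using Suc.prems that by (intro has_derivative_add Ck_on_Suc_has_derivative)
    show "Ck_on k U (\<lambda>p. frechet_derivative f (at p) h + frechet_derivative g (at p) h)" for h
      using Suc.prems by (auto intro: Suc.IH)
  qed
qed

text \<open>By the product rule the derivative is again a sum of values of \<open>B\<close>, now at functions of class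
  \<open>C\<^sup>k\<close>, so the induction has to generalize over both factors.\<close>
lemma Ck_on_bounded_bilinear:
  assumes "open U" "bounded_bilinear B" "Ck_on k U f" "Ck_on k U g"
  shows "Ck_on k U (\<lambda>p. B (f p) (g p))"
  using assms(3,4)
proof (induction k arbitrary: f g)
  case 0
  then show ?case
    by (simp add: bounded_bilinear.continuous_on[OF assms(2)])
next
  case (Suc k)
  show ?case
  proof (rule Ck_on_SucI[OF assms(1)])
    show "((\<lambda>p. B (f p) (g p)) has_derivative
        (\<lambda>h. B (f p) (frechet_derivative g (at p) h) + B (frechet_derivative f (at p) h) (g p))) (at p)"
      if "p \<in> U" for p
      using Suc.prems that
      by (intro bounded_bilinear.FDERIV[OF assms(2)] Ck_on_Suc_has_derivative)
    have "Ck_on k U f" "Ck_on k U g"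
      using Suc.prems by (auto intro: Ck_on_Suc_imp_Ck_on simp del: Ck_on.simps)
    moreover have "Ck_on k U (\<lambda>p. frechet_derivative f (at p) h)"
      "Ck_on k U (\<lambda>p. frechet_derivative g (at p) h)" for h
      using Suc.prems by simp_all
    ultimately show "Ck_on k U (\<lambda>p. B (f p) (frechet_derivative g (at p) h)
        + B (frechet_derivative f (at p) h) (g p))" for h
      by (intro Ck_on_add[OF assms(1)] Suc.IH)
  qed
qed

text \<open>The derivative of \<open>1 / f\<close> is a polynomial in \<open>1 / f\<close> and the derivative of \<open>f\<close>, so the
  regularity of \<open>1 / f\<close> improves by one order at each step of the induction.\<close>
lemma Ck_on_inverse:
  fixes f :: "'a::real_normed_vector \<Rightarrow> real"
  assumes "open U" "Ck_on k U f" "\<And>p. p \<in> U \<Longrightarrow> f p \<noteq> 0"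
  shows "Ck_on k U (\<lambda>p. inverse (f p))"
  using assms(2)
proof (induction k)
  case 0
  then show ?case
    using assms(3) by (auto intro!: continuous_on_inverse)
next
  case (Suc k)
  show ?case
  proof (rule Ck_on_SucI[OF assms(1)])
    show "((\<lambda>p. inverse (f p)) has_derivative
        (\<lambda>h. - (inverse (f p) * frechet_derivative f (at p) h * inverse (f p)))) (at p)"
      if "p \<in> U" for p
      by (rule Deriv.has_derivative_inverse[OF assms(3)[OF that]
            Ck_on_Suc_has_derivative[OF Suc.prems that]])
    have "Ck_on k U (\<lambda>p. inverse (f p))"
      by (rule Suc.IH[OF Ck_on_Suc_imp_Ck_on[OF Suc.prems]])
    moreover have "Ck_on k U (\<lambda>p. frechet_derivative f (at p) h)" for h
      using Suc.prems by simp
    ultimately show "Ck_on k U (\<lambda>p. - (inverse (f p) * frechet_derivative f (at p) h * inverse (f p)))" for h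
      by (intro Ck_on_bounded_linear[OF assms(1) bounded_linear_minus[OF bounded_linear_ident]]
          Ck_on_bounded_bilinear[OF assms(1) bounded_bilinear_mult])
  qed
qed

lemma smooth_on_cong:
  assumes "open U" "\<And>p. p \<in> U \<Longrightarrow> f p = g p"
  shows "smooth_on U f \<longleftrightarrow> smooth_on U g"
  using Ck_on_cong[OF assms] by (simp add: smooth_on_def)

lemma smooth_on_bounded_bilinear:
  assumes "open U" "bounded_bilinear B" "smooth_on U f" "smooth_on U g"
  shows "smooth_on U (\<lambda>p. B (f p) (g p))"
  unfolding smooth_on_def
  by (intro allI Ck_on_bounded_bilinear[OF assms(1,2)] assms(3,4)[unfolded smooth_on_def, rule_format])

lemma smooth_on_bounded_linear:
  assumes "open U" "bounded_linear L" "smooth_on U f"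
  shows "smooth_on U (\<lambda>p. L (f p))"
  unfolding smooth_on_def
  by (intro allI Ck_on_bounded_linear[OF assms(1,2)] assms(3)[unfolded smooth_on_def, rule_format])

lemma smooth_on_add:
  assumes "open U" "smooth_on U f" "smooth_on U g"
  shows "smooth_on U (\<lambda>p. f p + g p)"
  unfolding smooth_on_def
  by (intro allI Ck_on_add[OF assms(1)] assms(2,3)[unfolded smooth_on_def, rule_format])

lemma smooth_on_inverse:
  fixes f :: "'a::real_normed_vector \<Rightarrow> real"
  assumes "open U" "smooth_on U f" "\<And>p. p \<in> U \<Longrightarrow> f p \<noteq> 0"
  shows "smooth_on U (\<lambda>p. inverse (f p))"
  unfolding smooth_on_def
  by (intro allI Ck_on_inverse[OF assms(1)] assms(3) assms(2)[unfolded smooth_on_def, rule_format])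

lemma smooth_on_const: "smooth_on U (\<lambda>_. c)"
  by (simp add: smooth_on_def Ck_on_const)

lemma partial_eq:
  assumes "(f has_derivative F) (at p)"
  shows "partial i f p = F (axis i 1)"
proof -
  have "((\<lambda>t. p + t *\<^sub>R axis i 1) has_derivative (\<lambda>t. t *\<^sub>R axis i 1)) (at (0::real))"
    by (auto intro!: derivative_eq_intros)
  from has_derivative_compose[OF this, of f F] assms
  have "((\<lambda>t. f (p + t *\<^sub>R axis i 1)) has_derivative (\<lambda>t. F (t *\<^sub>R axis i 1))) (at 0)"
    by simp
  moreover have "F (t *\<^sub>R axis i 1) = t *\<^sub>R F (axis i 1)" for t
    using assms by (simp add: has_derivative_linear linear_scale)
  ultimately show ?thesis
    unfolding partial_def
    by (intro vector_derivative_at) (simp add: has_vector_derivative_def)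
qed

section \<open>Conformality of the projection\<close>

definition space_part :: "real^4 \<Rightarrow> real^3" where
  "space_part x = vector [x$2, x$3, x$4]"

lemma bounded_linear_space_part: "bounded_linear space_part"
  by (rule linear_conv_bounded_linear[THEN iffD1], rule linearI)
    (simp_all add: space_part_def vec_eq_iff forall_3)

lemma lorentz_space_part: "lorentz x y = - (x$1 * y$1) + space_part x \<bullet> space_part y"
  by (simp add: lorentz_def space_part_def inner_vec_def sum_3)

lemma bar_point_space_part: "bar_point x = inverse (x$1 + 1) *\<^sub>R space_part x"
  by (simp add: bar_point_def space_part_def vec_eq_iff forall_3 divide_inverse mult.commute)

text \<open>The vector \<open>(p, q, r)\<close> before normalization. For \<open>x\<close> on the hyperboloid it is, as a
  function of \<open>y\<close>, a negative multiple of the differential of \<open>bar_point\<close> at \<open>x\<close>.\<close>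
definition pre_normal :: "real^4 \<Rightarrow> real^4 \<Rightarrow> real^3" where
  "pre_normal x y = y$1 *\<^sub>R space_part x - (x$1 + 1) *\<^sub>R space_part y"

lemma bar_normal_pre_normal: "bar_normal x y = (1 / norm (pre_normal x y)) *\<^sub>R pre_normal x y"
proof -
  have "pre_normal x y = vector [x$2 * y$1 - x$1 * y$2 - y$2,
      x$3 * y$1 - x$1 * y$3 - y$3, x$4 * y$1 - x$1 * y$4 - y$4]"
    by (simp add: pre_normal_def space_part_def vec_eq_iff forall_3 algebra_simps)
  then show ?thesis
    by (simp add: bar_normal_def Let_def norm_vec_def L2_set_def sum_3)
qed

lemma pre_normal_combination:
  "pre_normal x (a *\<^sub>R y + b *\<^sub>R z) = a *\<^sub>R pre_normal x y + b *\<^sub>R pre_normal x z"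
  by (simp add: pre_normal_def space_part_def vec_eq_iff forall_3 algebra_simps)

text \<open>Conformality: orthogonality to \<open>x\<close> turns the products of the space part of \<open>x\<close> with those of
  \<open>y\<close> and \<open>z\<close> into products of time coordinates, and \<open>\<langle>x, x\<rangle> = -1\<close> makes the terms
  containing the space part of \<open>x\<close> collapse to \<open>- (x\<^sub>1 + 1)\<^sup>2 y\<^sub>1 z\<^sub>1\<close>.\<close>
lemma pre_normal_inner:
  assumes "lorentz x x = -1" "lorentz x y = 0" "lorentz x z = 0"
  shows "pre_normal x y \<bullet> pre_normal x z = (x$1 + 1)\<^sup>2 * lorentz y z"
proof -
  have *: "space_part x \<bullet> space_part x = (x$1)\<^sup>2 - 1" "space_part x \<bullet> space_part y = x$1 * y$1"
    "space_part y \<bullet> space_part x = x$1 * y$1"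
    "space_part x \<bullet> space_part z = x$1 * z$1"
    using assms by (auto simp: lorentz_space_part power2_eq_square inner_commute)
  show ?thesis
    by (simp add: pre_normal_def lorentz_space_part[of y z] inner_diff_left inner_diff_right *)
      (simp add: algebra_simps power2_eq_square)
qed

text \<open>On the hyperboloid the norm in the denominator is the positive number \<open>x\<^sub>1 + 1\<close>. Removing the
  square root also makes smoothness of the projected normals evident.\<close>
lemma bar_normal_eq:
  assumes "x \<in> H3" "y \<in> S31" "lorentz x y = 0"
  shows "bar_normal x y = inverse (x$1 + 1) *\<^sub>R pre_normal x y"
proof -
  have "(norm (pre_normal x y))\<^sup>2 = (x$1 + 1)\<^sup>2"
    using assms by (simp add: power2_norm_eq_inner pre_normal_inner H3_def S31_def)
  moreover have "x$1 + 1 > 0"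
    using assms by (simp add: H3_def)
  ultimately have "norm (pre_normal x y) = x$1 + 1"
    by (metis norm_ge_zero less_imp_le power2_eq_iff_nonneg)
  then show ?thesis
    by (simp add: bar_normal_pre_normal inverse_eq_divide)
qed

lemma bar_normals_in_Delta:
  assumes "x \<in> H3" "(y, z) \<in> Delta5" "lorentz x y = 0" "lorentz x z = 0"
  shows "(bar_normal x y, bar_normal x z) \<in> Delta"
proof -
  have *: "x$1 + 1 \<noteq> 0" "lorentz x x = -1" "y \<in> S31" "z \<in> S31" "lorentz y z = 0"
    "lorentz y y = 1" "lorentz z z = 1"
    using assms by (auto simp: H3_def Delta5_def S31_def)
  have square: "inverse c * (inverse c * c\<^sup>2) = 1" if "c \<noteq> 0" for c :: real
    using that by (simp add: power2_eq_square mult.assoc[symmetric])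
  have "bar_normal x y \<bullet> bar_normal x y = 1" "bar_normal x z \<bullet> bar_normal x z = 1"
    "bar_normal x y \<bullet> bar_normal x z = 0"
    using * assms by (simp_all add: bar_normal_eq pre_normal_inner square)
  then show ?thesis
    by (simp add: Delta_def norm_eq_sqrt_inner)
qed

section \<open>The cross product of differentials of the projection\<close>

text \<open>Expansion along the first row, for reading off the coordinates of \<open>wedge3\<close>.\<close>
lemma det_4:
  "det (A::'a::comm_ring_1^4^4) =
    A$1$1 * (A$2$2 * (A$3$3 * A$4$4 - A$3$4 * A$4$3) - A$2$3 * (A$3$2 * A$4$4 - A$3$4 * A$4$2)
      + A$2$4 * (A$3$2 * A$4$3 - A$3$3 * A$4$2))
    - A$1$2 * (A$2$1 * (A$3$3 * A$4$4 - A$3$4 * A$4$3) - A$2$3 * (A$3$1 * A$4$4 - A$3$4 * A$4$1)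
      + A$2$4 * (A$3$1 * A$4$3 - A$3$3 * A$4$1))
    + A$1$3 * (A$2$1 * (A$3$2 * A$4$4 - A$3$4 * A$4$2) - A$2$2 * (A$3$1 * A$4$4 - A$3$4 * A$4$1)
      + A$2$4 * (A$3$1 * A$4$2 - A$3$2 * A$4$1))
    - A$1$4 * (A$2$1 * (A$3$2 * A$4$3 - A$3$3 * A$4$2) - A$2$2 * (A$3$1 * A$4$3 - A$3$3 * A$4$1)
      + A$2$3 * (A$3$1 * A$4$2 - A$3$2 * A$4$1))"
proof -
  have f: "finite {2::4, 3, 4}" "1 \<notin> {2::4, 3, 4}" "finite {3::4, 4}" "2 \<notin> {3::4, 4}"
    "finite {4::4}" "3 \<notin> {4::4}"
    by auto
  show ?thesis
    unfolding det_def UNIV_4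
    unfolding sum_over_permutations_insert[OF f(1,2)]
    unfolding sum_over_permutations_insert[OF f(3,4)]
    unfolding sum_over_permutations_insert[OF f(5,6)]
    unfolding permutes_sing
    by (simp add: sign_swap_id permutation_swap_id sign_compose sign_id algebra_simps
        permutation_compose)
qed

lemma wedge3_time: "wedge3 x a b $ 1 = - (space_part x \<bullet> cross3 (space_part a) (space_part b))"
  using wedge3[of "axis 1 1" x a b, unfolded lorentz_axis]
  by (simp add: det_4 vector_4_nth axis_def space_part_def cross3_def inner_vec_def
      sum_3 algebra_simps)

lemma wedge3_space:
  "space_part (wedge3 x a b) =
    a$1 *\<^sub>R cross3 (space_part x) (space_part b) - x$1 *\<^sub>R cross3 (space_part a) (space_part b)
    - b$1 *\<^sub>R cross3 (space_part x) (space_part a)"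
  using wedge3[of "axis 2 1" x a b, unfolded lorentz_axis]
    wedge3[of "axis 3 1" x a b, unfolded lorentz_axis]
    wedge3[of "axis 4 1" x a b, unfolded lorentz_axis]
  by (simp add: det_4 vector_4_nth axis_def space_part_def cross3_def vec_eq_iff
      forall_3 algebra_simps)

text \<open>Expansion of \<open>X\<close> in the basis dual to \<open>X, A, B\<close>, multiplied through by the triple product so
  that it holds without independence of the three vectors.\<close>
lemma cross3_expand_along:
  "(X \<bullet> X) *\<^sub>R cross3 A B - (X \<bullet> A) *\<^sub>R cross3 X B + (X \<bullet> B) *\<^sub>R cross3 X A
    = (X \<bullet> cross3 A B) *\<^sub>R X"
  by (simp add: cross3_def inner_vec_def sum_3 vec_eq_iff forall_3 algebra_simps)

text \<open>With capital letters for space parts, both sides are combinations of \<open>A \<times> B\<close>, \<open>X \<times> A\<close>,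
  \<open>X \<times> B\<close> and \<open>X\<close>. The hypotheses read \<open>X \<bullet> X = x\<^sub>1\<^sup>2 - 1\<close>, \<open>X \<bullet> A = x\<^sub>1 a\<^sub>1\<close> and
  \<open>X \<bullet> B = x\<^sub>1 b\<^sub>1\<close>, and with these values the difference of the sides is \<open>x\<^sub>1 + 1\<close> times the
  identity \<open>cross3_expand_along\<close>.\<close>
lemma cross3_pre_normal:
  assumes "lorentz x x = -1" "lorentz x a = 0" "lorentz x b = 0"
  shows "cross3 (pre_normal x a) (pre_normal x b) = (x$1 + 1) *\<^sub>R pre_normal x (wedge3 x a b)"
proof -
  let ?X = "space_part x" and ?A = "space_part a" and ?B = "space_part b"
  have *: "?X \<bullet> ?X = (x$1)\<^sup>2 - 1" "?X \<bullet> ?A = x$1 * a$1" "?X \<bullet> ?B = x$1 * b$1"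
    using assms by (auto simp: lorentz_space_part power2_eq_square)
  note exp = cross3_expand_along[of ?X ?A ?B, unfolded *]
  have n: "pre_normal x (wedge3 x a b) = - ((?X \<bullet> cross3 ?A ?B) *\<^sub>R ?X)
     - (x$1 + 1) *\<^sub>R (a$1 *\<^sub>R cross3 ?X ?B - x$1 *\<^sub>R cross3 ?A ?B - b$1 *\<^sub>R cross3 ?X ?A)"
    by (simp add: pre_normal_def wedge3_time wedge3_space)
  have "cross3 (pre_normal x a) (pre_normal x b) =
     (x$1 + 1) *\<^sub>R ((x$1 + 1) *\<^sub>R cross3 ?A ?B + b$1 *\<^sub>R cross3 ?X ?A - a$1 *\<^sub>R cross3 ?X ?B)"
    by (simp add: pre_normal_def cross3_def vec_eq_iff forall_3 algebra_simps)
  also have "\<dots> = (x$1 + 1) *\<^sub>R pre_normal x (wedge3 x a b)"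
    unfolding n exp[symmetric]
    by (simp add: vec_eq_iff algebra_simps power2_eq_square)
  finally show ?thesis .
qed

section \<open>The projected surface\<close>

lemma bar_point_in_D3:
  assumes "x \<in> H3"
  shows "bar_point x \<in> D3"
proof -
  have x: "space_part x \<bullet> space_part x = (x$1 + 1) * (x$1 - 1)" "x$1 > 0"
    using assms by (auto simp: H3_def lorentz_space_part algebra_simps)
  have "bar_point x \<bullet> bar_point x = (x$1 - 1) / (x$1 + 1)"
    using x(2) by (simp add: bar_point_space_part x(1) divide_inverse)
  also have "\<dots> < 1"
    using x(2) by simp
  finally show ?thesis
    by (simp add: D3_def inner_vec_def sum_3 power2_eq_square)
qed

lemma bounded_bilinear_lorentz: "bounded_bilinear lorentz"
  by (rule bilinear_conv_bounded_bilinear[THEN iffD1])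
    (auto intro!: linearI simp: bilinear_def lorentz_def algebra_simps)

lemma lorentz_partial_eq_0:
  assumes "open U" "p \<in> U" "x differentiable (at p)" "\<And>q. q \<in> U \<Longrightarrow> lorentz (x q) (x q) = c"
  shows "lorentz (x p) (partial i x p) = 0"
proof -
  obtain F where F: "(x has_derivative F) (at p)"
    using assms(3) by (auto simp: differentiable_def)
  have "((\<lambda>q. lorentz (x q) (x q)) has_derivative
      (\<lambda>h. lorentz (x p) (F h) + lorentz (F h) (x p))) (at p)"
    by (rule bounded_bilinear.FDERIV[OF bounded_bilinear_lorentz F F])
  moreover have "((\<lambda>q. lorentz (x q) (x q)) has_derivative (\<lambda>h. 0)) (at p)"
    by (rule has_derivative_transform_within_open[OF has_derivative_const assms(1,2)])
      (simp add: assms(4))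
  ultimately have "(\<lambda>h. lorentz (x p) (F h) + lorentz (F h) (x p)) = (\<lambda>h. 0)"
    by (rule has_derivative_unique)
  then have "lorentz (x p) (F h) + lorentz (F h) (x p) = 0" for h
    by (rule fun_cong)
  moreover have "lorentz (F h) (x p) = lorentz (x p) (F h)" for h
    by (simp add: lorentz_def algebra_simps)
  ultimately show ?thesis
    by (simp add: partial_eq[OF F])
qed

lemma bar_point_has_derivative:
  assumes "x$1 + 1 \<noteq> 0"
  shows "(bar_point has_derivative (\<lambda>w. - ((inverse (x$1 + 1))\<^sup>2 *\<^sub>R pre_normal x w))) (at x)"
proof -
  have S: "(space_part has_derivative space_part) (at x)"
    by (rule bounded_linear_imp_has_derivative[OF bounded_linear_space_part])
  have T: "((\<lambda>x::real^4. x$1 + 1) has_derivative (\<lambda>w. w$1)) (at x)"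
    by (rule has_derivative_add_const[OF bounded_linear_imp_has_derivative[OF bounded_linear_vec_nth]])
  have "((\<lambda>x. inverse (x$1 + 1) *\<^sub>R space_part x) has_derivative
      (\<lambda>w. inverse (x$1 + 1) *\<^sub>R space_part w
        + (- (inverse (x$1 + 1) * w$1 * inverse (x$1 + 1))) *\<^sub>R space_part x)) (at x)"
    by (rule has_derivative_scaleR[OF Deriv.has_derivative_inverse[OF assms T] S])
  moreover have "inverse (x$1 + 1) *\<^sub>R space_part w
      + (- (inverse (x$1 + 1) * w$1 * inverse (x$1 + 1))) *\<^sub>R space_part x
      = - ((inverse (x$1 + 1))\<^sup>2 *\<^sub>R pre_normal x w)" for w
    using assms
    by (simp add: pre_normal_def power2_eq_square scaleR_diff_right mult_ac)
  ultimately show ?thesis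
    by (simp add: bar_point_space_part[abs_def])
qed

lemma partial_bar_point:
  assumes "x differentiable (at p)" "x p $ 1 + 1 \<noteq> 0"
  shows "partial i (\<lambda>p. bar_point (x p)) p
    = - ((inverse (x p $ 1 + 1))\<^sup>2 *\<^sub>R pre_normal (x p) (partial i x p))"
proof -
  obtain F where F: "(x has_derivative F) (at p)"
    using assms(1) by (auto simp: differentiable_def)
  show ?thesis
    by (simp add: partial_eq[OF has_derivative_compose[OF F bar_point_has_derivative[OF assms(2)]]]
        partial_eq[OF F])
qed

text \<open>Two differentials contribute \<open>(x\<^sub>1 + 1)\<^sup>-\<^sup>4\<close> and \<open>cross3_pre_normal\<close> one factor
  \<open>x\<^sub>1 + 1\<close>, whence the exponent three.\<close>
lemma cross3_partial_bar_point:
  assumes "open U" "p \<in> U" "x differentiable (at p)" "\<And>q. q \<in> U \<Longrightarrow> x q \<in> H3"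
  shows "cross3 (partial_u (\<lambda>p. bar_point (x p)) p) (partial_v (\<lambda>p. bar_point (x p)) p)
    = (inverse (x p $ 1 + 1)) ^ 3 *\<^sub>R pre_normal (x p) (wedge3 (x p) (partial_u x p) (partial_v x p))"
proof -
  have x: "lorentz (x q) (x q) = -1" "x q $ 1 + 1 \<noteq> 0" if "q \<in> U" for q
    using assms(4)[OF that] by (auto simp: H3_def)
  have tangent: "lorentz (x p) (partial i x p) = 0" for i
    by (rule lorentz_partial_eq_0[OF assms(1-3) x(1)])
  show ?thesis
    using x(2)[OF assms(2)]
    by (simp add: partial_bar_point[OF assms(3) x(2)[OF assms(2)]] cross_mult_left cross_mult_right
        cross3_pre_normal[OF x(1)[OF assms(2)] tangent tangent] power2_eq_square power3_eq_cube)
qed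

lemma smooth_on_inverse_time:
  assumes "open U" "smooth_on U x" "\<And>p. p \<in> U \<Longrightarrow> x p \<in> H3"
  shows "smooth_on U (\<lambda>p. inverse (x p $ 1 + 1))"
proof (rule smooth_on_inverse[OF assms(1)])
  show "smooth_on U (\<lambda>p. x p $ 1 + 1)"
    by (intro smooth_on_add[OF assms(1)] smooth_on_const
        smooth_on_bounded_linear[OF assms(1) bounded_linear_vec_nth] assms(2))
  show "x p $ 1 + 1 \<noteq> 0" if "p \<in> U" for p
    using assms(3)[OF that] by (simp add: H3_def)
qed

lemma smooth_on_bar_point:
  assumes "open U" "smooth_on U x" "\<And>p. p \<in> U \<Longrightarrow> x p \<in> H3"
  shows "smooth_on U (\<lambda>p. bar_point (x p))"
  unfolding bar_point_space_part
  by (intro smooth_on_bounded_bilinear[OF assms(1) bounded_bilinear_scaleR]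
      smooth_on_inverse_time smooth_on_bounded_linear[OF assms(1) bounded_linear_space_part] assms)

lemma smooth_on_bar_normal:
  assumes "open U" "smooth_on U x" "smooth_on U \<nu>"
    and "\<And>p. p \<in> U \<Longrightarrow> x p \<in> H3" "\<And>p. p \<in> U \<Longrightarrow> \<nu> p \<in> S31"
    and "\<And>p. p \<in> U \<Longrightarrow> lorentz (x p) (\<nu> p) = 0"
  shows "smooth_on U (\<lambda>p. bar_normal (x p) (\<nu> p))"
proof -
  have eq: "bar_normal (x p) (\<nu> p) = (\<nu> p $ 1) *\<^sub>R bar_point (x p) + - space_part (\<nu> p)"
    if "p \<in> U" for p
    using assms(4)[OF that]
    by (simp add: bar_normal_eq[OF assms(4-6)[OF that]] pre_normal_def bar_point_space_part
        scaleR_diff_right H3_def)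
  have "smooth_on U (\<lambda>p. (\<nu> p $ 1) *\<^sub>R bar_point (x p) + - space_part (\<nu> p))"
    by (intro smooth_on_add[OF assms(1)]
        smooth_on_bounded_bilinear[OF assms(1) bounded_bilinear_scaleR] smooth_on_bar_point
        smooth_on_bounded_linear[OF assms(1) bounded_linear_vec_nth]
        smooth_on_bounded_linear[OF assms(1) bounded_linear_minus[OF bounded_linear_space_part]]
        assms)
  then show ?thesis
    by (rule smooth_on_cong[OF assms(1), THEN iffD2, rotated]) (rule eq)
qed

theorem proposition4p1:
  fixes U :: "(real^2) set"
    and x \<nu>\<^sub>1 \<nu>\<^sub>2 :: "real^2 \<Rightarrow> real^4"
  assumes "open U" and "simply_connected U"
    and "hyperbolic_generalized_framed_surface U x \<nu>\<^sub>1 \<nu>\<^sub>2"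
  shows "(\<forall>p\<in>U. bar_point (x p) \<in> D3) \<and>
    generalized_framed_surface U
      (\<lambda>p. bar_point (x p))
      (\<lambda>p. bar_normal (x p) (\<nu>\<^sub>1 p))
      (\<lambda>p. bar_normal (x p) (\<nu>\<^sub>2 p))"
proof -
  let ?t = "\<lambda>p. inverse (x p $ 1 + 1)"
  have smooth: "smooth_on U x" "smooth_on U \<nu>\<^sub>1" "smooth_on U \<nu>\<^sub>2"
    and H3: "\<And>p. p \<in> U \<Longrightarrow> x p \<in> H3"
    and Delta5: "\<And>p. p \<in> U \<Longrightarrow> (\<nu>\<^sub>1 p, \<nu>\<^sub>2 p) \<in> Delta5"
    and normal: "\<And>p. p \<in> U \<Longrightarrow> lorentz (x p) (\<nu>\<^sub>1 p) = 0" "\<And>p. p \<in> U \<Longrightarrow> lorentz (x p) (\<nu>\<^sub>2 p) = 0"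
    using assms(3) by (auto simp: hyperbolic_generalized_framed_surface_def)
  have S31: "\<nu>\<^sub>1 p \<in> S31" "\<nu>\<^sub>2 p \<in> S31" if "p \<in> U" for p
    using Delta5[OF that] by (auto simp: Delta5_def)
  obtain \<alpha> \<beta> :: "real^2 \<Rightarrow> real" where coeffs: "smooth_on U \<alpha>" "smooth_on U \<beta>"
    and wedge: "\<And>p. p \<in> U \<Longrightarrow>
      wedge3 (x p) (partial_u x p) (partial_v x p) = \<alpha> p *\<^sub>R \<nu>\<^sub>1 p + \<beta> p *\<^sub>R \<nu>\<^sub>2 p"
    using assms(3) by (auto simp: hyperbolic_generalized_framed_surface_def)
  have scaled: "smooth_on U (\<lambda>p. ?t p * ?t p * f p)" if "smooth_on U f" for f
    by (intro smooth_on_bounded_bilinear[OF assms(1) bounded_bilinear_mult]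
        smooth_on_inverse_time assms(1) smooth(1) H3 that)
  have "cross3 (partial_u (\<lambda>p. bar_point (x p)) p) (partial_v (\<lambda>p. bar_point (x p)) p)
      = (?t p * ?t p * \<alpha> p) *\<^sub>R bar_normal (x p) (\<nu>\<^sub>1 p)
        + (?t p * ?t p * \<beta> p) *\<^sub>R bar_normal (x p) (\<nu>\<^sub>2 p)" if "p \<in> U" for p
  proof -
    have "Ck_on (Suc 0) U x"
      using smooth(1) unfolding smooth_on_def by blast
    then have "x differentiable (at p)"
      using that by simp
    from cross3_partial_bar_point[OF assms(1) that this H3] show ?thesis
      by (simp add: wedge[OF that] pre_normal_combination bar_normal_eq H3 S31 normal that
          scaleR_add_right power3_eq_cube mult_ac)
  qed
  with scaled[OF coeffs(1)] scaled[OF coeffs(2)] have "\<exists>\<alpha> \<beta> :: real^2 \<Rightarrow> real.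
      smooth_on U \<alpha> \<and> smooth_on U \<beta> \<and> (\<forall>p\<in>U.
        cross3 (partial_u (\<lambda>p. bar_point (x p)) p) (partial_v (\<lambda>p. bar_point (x p)) p)
          = \<alpha> p *\<^sub>R bar_normal (x p) (\<nu>\<^sub>1 p) + \<beta> p *\<^sub>R bar_normal (x p) (\<nu>\<^sub>2 p))"
    by (intro exI[of _ "\<lambda>p. ?t p * ?t p * \<alpha> p"] exI[of _ "\<lambda>p. ?t p * ?t p * \<beta> p"]) simp
  then show ?thesis
    unfolding generalized_framed_surface_def
    by (intro conjI ballI bar_point_in_D3 bar_normals_in_Delta H3 Delta5 normal
        smooth_on_bar_point smooth_on_bar_normal assms(1) smooth S31)
qed

end
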